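(* Let $S$ be a free semigroup and let $T$ be a free subsemigroup of $S$. If $\mathrm{Sep}T\neq\emptyset$, then $\mathrm{Sep}T$ is a free subsemigroup of $S$.
   Context: For a subset $A$ of a semigroup $S$, write $\overline{A}=S\setminus A$. The separator of $A$, denoted $\mathrm{Sep}A$, is the set of all $x\in S$ such that $xA\subseteq A$, $Ax\subseteq A$, $x\overline{A}\subseteq\overline{A}$ and $\overline{A}x\subseteq\overline{A}$. A free semigroup is a semigroup isomorphic to the semigroup of all non-empty finite words over some non-empty alphabet under concatenation (no identity element). A free subsemigroup of $S$ is a (non-empty) subsemigroup of $S$ that is itself a free semigroup. *)

theory Defs
  imports Main
begin

text \<open>The ambient semigroup is a type of class \<open>semigroup_mult\<close>; its universe plays the
  role of \<open>S\<close>, so that \<open>- A\<close> is the complement of \<open>A\<close> in \<open>S\<close>.\<close>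

definition words :: "'b set \<Rightarrow> 'b list set" where
  "words X = lists X - {[]}"

definition word_iso :: "'b set \<Rightarrow> ('b list \<Rightarrow> 'a::semigroup_mult) \<Rightarrow> 'a set \<Rightarrow> bool" where
  "word_iso X \<phi> T \<longleftrightarrow> bij_betw \<phi> (words X) T \<and>
     (\<forall>u \<in> words X. \<forall>v \<in> words X. \<phi> (u @ v) = \<phi> u * \<phi> v)"

text \<open>The definition takes alphabets from the type of the semigroup itself, since HOL cannot
  quantify over types. This loses no generality: by \<open>word_iso_imp_free_semigroup\<close> below, an
  isomorphism with the words over an alphabet of any other type suffices.\<close>

definition free_semigroup :: "'a::semigroup_mult set \<Rightarrow> bool" where
  "free_semigroup T \<longleftrightarrow> (\<exists>(X :: 'a set) \<phi>. X \<noteq> {} \<and> word_iso X \<phi> T)"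

definition subsemigroup :: "'a::semigroup_mult set \<Rightarrow> bool" where
  "subsemigroup T \<longleftrightarrow> T \<noteq> {} \<and> (\<forall>x \<in> T. \<forall>y \<in> T. x * y \<in> T)"

definition free_subsemigroup :: "'a::semigroup_mult set \<Rightarrow> bool" where
  "free_subsemigroup T \<longleftrightarrow> subsemigroup T \<and> free_semigroup T"

definition Sep :: "'a::semigroup_mult set \<Rightarrow> 'a set" where
  "Sep A = {x. (\<lambda>a. x * a) ` A \<subseteq> A \<and> (\<lambda>a. a * x) ` A \<subseteq> A \<and>
               (\<lambda>a. x * a) ` (- A) \<subseteq> - A \<and> (\<lambda>a. a * x) ` (- A) \<subseteq> - A}"

lemma word_iso_imp_free_semigroup:
  fixes X :: "'b set" and T :: "'a::semigroup_mult set"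
  assumes X: "X \<noteq> {}" and iso: "word_iso X \<phi> T"
  shows "free_semigroup T"
proof -
  define f where "f = (\<lambda>x. \<phi> [x])"
  define g where "g = inv_into X f"
  define Y where "Y = f ` X"
  have inj\<phi>: "inj_on \<phi> (words X)" and img: "\<phi> ` words X = T"
    using iso by (auto simp: word_iso_def bij_betw_def)
  have "inj_on f X"
  proof (rule inj_onI)
    fix x y assume "x \<in> X" "y \<in> X" "f x = f y"
    then show "x = y"
      using inj_onD[OF inj\<phi>, of "[x]" "[y]"] by (auto simp: f_def words_def)
  qed
  then have g: "bij_betw g Y X"
    unfolding g_def Y_def by (intro bij_betw_inv_into) (simp add: bij_betw_def)
  then have "bij_betw (map g) (lists Y) (lists X)"
    by (rule bij_lists)
  then have "bij_betw (map g) (words Y) (words X)"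
    unfolding words_def bij_betw_def by (auto intro: inj_on_subset)
  then have bij: "bij_betw (\<phi> \<circ> map g) (words Y) T"
    using iso unfolding word_iso_def by (auto intro: bij_betw_trans)
  have "map g u \<in> words X" if "u \<in> words Y" for u
    using that g by (auto simp: words_def bij_betw_def)
  then have "word_iso Y (\<phi> \<circ> map g) T"
    using iso bij by (simp add: word_iso_def)
  moreover have "Y \<noteq> {}" using X by (simp add: Y_def)
  ultimately show ?thesis unfolding free_semigroup_def by blast
qed

end

theory Submission imports Defs
begin

text \<open>An element \<open>x\<close> lies in \<open>Sep T\<close> iff multiplying by \<open>x\<close> on either side neither creates nor
  destroys membership in \<open>T\<close>. Hence \<open>N = Sep T\<close> satisfies Schuetzenberger's stability condition:
  if \<open>n\<close>, \<open>m\<close>, \<open>n w\<close>, \<open>w m\<close> are in \<open>N\<close>, then so is \<open>w\<close>, because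
  \<open>w a \<in> T\<close> iff \<open>n w a \<in> T\<close> iff \<open>a \<in> T\<close>, and dually. A stable subsemigroup of a free semigroup is
  free on its irreducible elements: word length gives factorisations into irreducibles, and two
  factorisations that differ in their first factors \<open>x = y w\<close> would force \<open>w \<in> N\<close>.\<close>

text \<open>No identity is available as an empty product, so the value at \<open>[]\<close> stays
  unspecified and the \<open>if\<close> keeps it out of every product of a non-empty word.\<close>

primrec sprod :: "'a::semigroup_mult list \<Rightarrow> 'a" where
  "sprod (x # xs) = (if xs = [] then x else x * sprod xs)"

lemma sprod_append:
  "u \<noteq> [] \<Longrightarrow> v \<noteq> [] \<Longrightarrow> sprod (u @ v) = sprod u * sprod v"
  by (induction u) (auto simp: mult.assoc)

lemma sprod_closed:
  assumes "subsemigroup N" and "u \<noteq> []" and "set u \<subseteq> N"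
  shows "sprod u \<in> N"
  using assms(2,3) by (induction u) (use assms(1) in \<open>auto simp: subsemigroup_def\<close>)

text \<open>Word length is carried over along the inverse isomorphism \<open>\<psi>\<close>. It
  serves as the induction measure for factorisations.\<close>

lemma free_semigroup_length:
  assumes "free_semigroup (UNIV :: 'a::semigroup_mult set)"
  obtains len :: "'a::semigroup_mult \<Rightarrow> nat"
    where "\<And>a. 0 < len a" and "\<And>a b. len (a * b) = len a + len b"
proof -
  obtain X :: "'a set" and \<phi> where bij: "bij_betw \<phi> (words X) (UNIV :: 'a set)"
    and hom: "\<And>u v. u \<in> words X \<Longrightarrow> v \<in> words X \<Longrightarrow> \<phi> (u @ v) = \<phi> u * \<phi> v"
    using assms unfolding free_semigroup_def word_iso_def by blast
  define \<psi> where "\<psi> = inv_into (words X) \<phi>"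
  have \<psi>_words: "\<psi> a \<in> words X" and \<phi>_\<psi>: "\<phi> (\<psi> a) = a" for a
    using bij unfolding \<psi>_def bij_betw_def
    by (metis UNIV_I inv_into_into, metis UNIV_I f_inv_into_f)
  have \<psi>_mult: "\<psi> (a * b) = \<psi> a @ \<psi> b" for a b
  proof -
    have "\<psi> a @ \<psi> b \<in> words X"
      using \<psi>_words[of a] \<psi>_words[of b] by (auto simp: words_def)
    moreover have "\<phi> (\<psi> a @ \<psi> b) = a * b"
      by (simp add: hom \<psi>_words \<phi>_\<psi>)
    ultimately show ?thesis
      using bij_betw_inv_into_left[OF bij] unfolding \<psi>_def by metis
  qed
  show thesis
  proof (rule that)
    show "0 < length (\<psi> a)" for a
      using \<psi>_words[of a] by (auto simp: words_def)
    show "length (\<psi> (a * b)) = length (\<psi> a) + length (\<psi> b)" for a b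
      by (simp add: \<psi>_mult)
  qed
qed

text \<open>Levi's lemma: two factorisations of one word are compared by where they cut it.\<close>

lemma free_semigroup_equidivisible:
  fixes a b c d :: "'a::semigroup_mult"
  assumes "free_semigroup (UNIV :: 'a set)" and eq: "a * b = c * d"
  shows "(a = c \<and> b = d) \<or> (\<exists>w. a = c * w \<and> w * b = d) \<or> (\<exists>w. c = a * w \<and> w * d = b)"
proof -
  obtain X :: "'a set" and \<phi> where bij: "bij_betw \<phi> (words X) (UNIV :: 'a set)"
    and hom: "\<And>u v. u \<in> words X \<Longrightarrow> v \<in> words X \<Longrightarrow> \<phi> (u @ v) = \<phi> u * \<phi> v"
    using assms(1) unfolding free_semigroup_def word_iso_def by blast
  have "\<exists>p \<in> words X. s = \<phi> p" for s
    using bij unfolding bij_betw_def by (metis UNIV_I imageE)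
  then obtain p q r t where words: "p \<in> words X" "q \<in> words X" "r \<in> words X" "t \<in> words X"
    and \<phi>: "a = \<phi> p" "b = \<phi> q" "c = \<phi> r" "d = \<phi> t"
    by metis
  have "p @ q \<in> words X" "r @ t \<in> words X"
    using words by (auto simp: words_def)
  moreover have "\<phi> (p @ q) = \<phi> (r @ t)"
    using eq words by (simp add: hom \<phi>)
  ultimately have "p @ q = r @ t"
    using bij by (auto simp: bij_betw_def dest: inj_onD)
  then obtain s where s: "p = r @ s \<and> s @ q = t \<or> p @ s = r \<and> q = s @ t"
    by (auto simp: append_eq_append_conv2)
  show ?thesis
  \<comment> \<open>Cuts at the same place leave \<open>s = []\<close>, which \<open>\<phi>\<close>
    does not turn into an element of the semigroup; hence the separate case of equal
    factors.\<close>
  proof (cases "s = []")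
    case True
    then show ?thesis using s \<phi> by auto
  next
    case False
    then have "s \<in> words X"
      using s words by (auto simp: words_def)
    then show ?thesis
      using s words by (auto simp: \<phi> hom)
  qed
qed

definition stable_set :: "'a::semigroup_mult set \<Rightarrow> bool" where
  "stable_set N \<longleftrightarrow> (\<forall>n \<in> N. \<forall>m \<in> N. \<forall>w. n * w \<in> N \<longrightarrow> w * m \<in> N \<longrightarrow> w \<in> N)"

definition irreducibles :: "'a::semigroup_mult set \<Rightarrow> 'a set" where
  "irreducibles N = {x \<in> N. \<forall>a \<in> N. \<forall>b \<in> N. x \<noteq> a * b}"

text \<open>A reducible element splits into two strictly shorter elements of \<open>N\<close>, so
  repeated splitting must stop.\<close>

lemma irreducible_factorisation:
  fixes N :: "'a::semigroup_mult set"
  assumes "free_semigroup (UNIV :: 'a set)" and "x \<in> N"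
  shows "\<exists>u \<in> words (irreducibles N). sprod u = x"
proof -
  obtain len :: "'a \<Rightarrow> nat"
    where pos: "\<And>a. 0 < len a" and add: "\<And>a b. len (a * b) = len a + len b"
    using free_semigroup_length[OF assms(1)] by metis
  show ?thesis
    using assms(2)
  proof (induction x rule: measure_induct_rule[of len])
    case (less x)
    show ?case
    proof (cases "x \<in> irreducibles N")
      case True
      then have "[x] \<in> words (irreducibles N)" "sprod [x] = x"
        by (auto simp: words_def)
      then show ?thesis by blast
    next
      case False
      then obtain a b where ab: "a \<in> N" "b \<in> N" "x = a * b"
        using less.prems by (auto simp: irreducibles_def)
      then have "len a < len x" "len b < len x"
        using pos[of a] pos[of b] by (auto simp: add)
      then obtain u v where uv: "u \<in> words (irreducibles N)" "sprod u = a"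
        "v \<in> words (irreducibles N)" "sprod v = b"
        using less.IH ab by metis
      then have "u @ v \<in> words (irreducibles N)" "sprod (u @ v) = x"
        using ab by (auto simp: words_def sprod_append)
      then show ?thesis by blast
    qed
  qed
qed

lemma irreducible_left_cancel:
  fixes N :: "'a::semigroup_mult set"
  assumes "free_semigroup (UNIV :: 'a set)" and "stable_set N"
    and x: "x \<in> irreducibles N" and y: "y \<in> irreducibles N"
    and N: "p \<in> N" "q \<in> N" and eq: "x * p = y * q"
  shows "x = y \<and> p = q"
proof -
  \<comment> \<open>This excludes both unequal cases of Levi's lemma: \<open>x = y * w\<close> with
    \<open>w * p = q\<close>, and the same with the two sides exchanged. Stability is applied with
    \<open>b\<close> on the left and \<open>r\<close> on the right of \<open>w\<close>.\<close>
  have False if "a \<in> irreducibles N" "b \<in> N" "r \<in> N" "w * r \<in> N" "a = b * w" for a b r w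
  proof -
    have "w \<in> N"
      using that \<open>stable_set N\<close> unfolding stable_set_def irreducibles_def by blast
    then show False
      using that by (auto simp: irreducibles_def)
  qed
  moreover have "x \<in> N" "y \<in> N"
    using x y by (auto simp: irreducibles_def)
  ultimately show ?thesis
    using free_semigroup_equidivisible[OF assms(1) eq] x y N by (elim disjE exE conjE) blast+
qed

lemma sprod_irreducibles_inj:
  fixes N :: "'a::semigroup_mult set"
  assumes free: "free_semigroup (UNIV :: 'a set)"
    and sub: "subsemigroup N" and st: "stable_set N"
  shows "inj_on sprod (words (irreducibles N))"
proof (rule inj_onI)
  fix u v :: "'a list"
  assume "u \<in> words (irreducibles N)" "v \<in> words (irreducibles N)" "sprod u = sprod v"
  then show "u = v"
  proof (induction u arbitrary: v)
    case Nil
    then show ?case by (simp add: words_def)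
  next
    case (Cons x u)
    then obtain y v' where v: "v = y # v'"
      by (cases v) (auto simp: words_def)
    have x: "x \<in> irreducibles N" and y: "y \<in> irreducibles N"
      and u: "set u \<subseteq> irreducibles N" and v': "set v' \<subseteq> irreducibles N"
      using Cons.prems by (auto simp: words_def v)
    have sub_N: "irreducibles N \<subseteq> N"
      by (auto simp: irreducibles_def)
    have u_N: "sprod u \<in> N" if "u \<noteq> []"
      using sprod_closed[OF sub that] u sub_N by blast
    have v_N: "sprod v' \<in> N" if "v' \<noteq> []"
      using sprod_closed[OF sub that] v' sub_N by blast
    show ?case
    proof (cases "u = [] \<or> v' = []")
      case True
      \<comment> \<open>If only one tail were empty, an irreducible letter would equal a product of
        two elements of \<open>N\<close>; so both tails are empty.\<close>
      then show ?thesis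
        using Cons.prems(3) x y u_N v_N by (auto simp: v irreducibles_def split: if_splits)
    next
      case False
      then have "x = y \<and> sprod u = sprod v'"
        using irreducible_left_cancel[OF free st x y] Cons.prems(3) u_N v_N by (auto simp: v)
      moreover have "u \<in> words (irreducibles N)" "v' \<in> words (irreducibles N)"
        using False u v' by (auto simp: words_def)
      ultimately show ?thesis
        using Cons.IH v by blast
    qed
  qed
qed

theorem stable_imp_free_semigroup:
  fixes N :: "'a::semigroup_mult set"
  assumes free: "free_semigroup (UNIV :: 'a set)"
    and sub: "subsemigroup N" and st: "stable_set N"
  shows "free_semigroup N"
proof -
  have "sprod u \<in> N" if "u \<in> words (irreducibles N)" for u
    using that by (intro sprod_closed[OF sub]) (auto simp: words_def irreducibles_def)
  then have "sprod ` words (irreducibles N) = N"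
    using irreducible_factorisation[OF free] by blast
  then have "bij_betw sprod (words (irreducibles N)) N"
    using sprod_irreducibles_inj[OF assms] by (simp add: bij_betw_def)
  then have "word_iso (irreducibles N) sprod N"
    by (auto simp: word_iso_def words_def sprod_append)
  moreover have "irreducibles N \<noteq> {}"
  proof
    assume "irreducibles N = {}"
    then have "N = {}"
      using irreducible_factorisation[OF free] by (fastforce simp: words_def)
    then show False
      using sub by (simp add: subsemigroup_def)
  qed
  ultimately show ?thesis
    unfolding free_semigroup_def by blast
qed

text \<open>Each inclusion for the complement is, by contraposition, the converse of the matching
  inclusion for \<open>A\<close>.\<close>

lemma Sep_iff:
  "x \<in> Sep A \<longleftrightarrow> (\<forall>a. (x * a \<in> A \<longleftrightarrow> a \<in> A) \<and> (a * x \<in> A \<longleftrightarrow> a \<in> A))"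
  unfolding Sep_def by blast

lemma subsemigroup_Sep: "Sep A \<noteq> {} \<Longrightarrow> subsemigroup (Sep A)"
  \<comment> \<open>To peel off one factor at a time, left multiplication needs brackets moved to
    the right and right multiplication needs them moved to the left.\<close>
  by (auto simp: subsemigroup_def Sep_iff mult.assoc) (simp_all flip: mult.assoc)

text \<open>The pair \<open>n\<close>, \<open>n * w\<close> governs multiplication by
  \<open>w\<close> on the left, and the pair \<open>m\<close>, \<open>w * m\<close> governs it on
  the right.\<close>

lemma stable_Sep: "stable_set (Sep A)"
proof -
  have "w \<in> Sep A" if "n \<in> Sep A" "m \<in> Sep A" "n * w \<in> Sep A" "w * m \<in> Sep A" for n m w
  proof -
    have "w * a \<in> A \<longleftrightarrow> a \<in> A" for a
    proof -
      have "w * a \<in> A \<longleftrightarrow> n * (w * a) \<in> A"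
        using that(1) by (simp add: Sep_iff)
      also have "\<dots> \<longleftrightarrow> a \<in> A"
        using that(3) by (simp add: Sep_iff flip: mult.assoc)
      finally show ?thesis .
    qed
    moreover have "a * w \<in> A \<longleftrightarrow> a \<in> A" for a
    proof -
      have "a * w \<in> A \<longleftrightarrow> (a * w) * m \<in> A"
        using that(2) by (simp add: Sep_iff)
      also have "\<dots> \<longleftrightarrow> a \<in> A"
        using that(4) by (simp add: Sep_iff mult.assoc)
      finally show ?thesis .
    qed
    ultimately show ?thesis
      by (simp add: Sep_iff)
  qed
  then show ?thesis
    unfolding stable_set_def by blast
qed

theorem theorem12:
  fixes T :: "'a::semigroup_mult set"
  assumes "free_semigroup (UNIV :: 'a set)"
    and "free_subsemigroup T"
    and "Sep T \<noteq> {}"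
  shows "free_subsemigroup (Sep T)"
  using stable_imp_free_semigroup[OF assms(1) subsemigroup_Sep[OF assms(3)] stable_Sep]
    subsemigroup_Sep[OF assms(3)]
  by (simp add: free_subsemigroup_def)

end
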